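(* Let $n\ge2$, $2\le k\le n$, $1\le p<\infty$ and let $\Omega\subset\mathbb{R}^n$ be nonempty, open and bounded. Let $$I(\omega):=\frac1p\int_\Omega|d\omega|^p-\frac1p\int_\Omega|\omega|^p\qquad\text{for all }\omega\in W^{d,p}(\Omega;\Lambda^{k-1}).$$ Then $I$ is not (sequentially) weakly lower semicontinuous in $W^{d,p}(\Omega;\Lambda^{k-1})$.
   Context: $\Lambda^{k}=\Lambda^k(\mathbb{R}^n)$ is the space of alternating $k$-linear forms on $\mathbb{R}^n$ with its Euclidean norm. $W^{d,p}(\Omega;\Lambda^{k-1})=\{\omega\in L^p(\Omega;\Lambda^{k-1}):d\omega\in L^p(\Omega;\Lambda^{k})\}$ ($d$ the distributional exterior derivative) with the graph norm; $\omega^\nu\rightharpoonup\omega$ in $W^{d,p}$ means $\omega^\nu\rightharpoonup\omega$ and $d\omega^\nu\rightharpoonup d\omega$ weakly in $L^p$. *)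

theory Defs
  imports "HOL-Analysis.Analysis"
begin

section \<open>Alternating forms\<close>

text \<open>
  A form of degree \<open>k\<close> is a real function of lists of vectors of length \<open>k\<close>; it is set to \<open>0\<close> on lists
  of any other length, so that equal forms are equal functions.
\<close>

type_synonym 'n form = "(real^'n) list \<Rightarrow> real"

definition alternating_forms :: "nat \<Rightarrow> 'n::finite form set" where
  "alternating_forms k = {\<alpha>.
     (\<forall>vs. length vs \<noteq> k \<longrightarrow> \<alpha> vs = 0) \<and>
     (\<forall>vs i. length vs = k \<and> i < k \<longrightarrow> linear (\<lambda>v. \<alpha> (vs[i := v]))) \<and>
     (\<forall>vs i j. length vs = k \<and> i < j \<and> j < k \<and> vs ! i = vs ! j \<longrightarrow> \<alpha> vs = 0)}"

text \<open>
  The Euclidean norm for which the forms \<open>dx\<^sup>I\<close>, with \<open>I\<close> an increasing multi-index of length \<open>k\<close>, are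
  orthonormal. The sum runs over all multi-indices; those with a repeated entry contribute \<open>0\<close> and
  each increasing one is counted \<open>k!\<close> times.
\<close>

definition form_norm :: "nat \<Rightarrow> 'n::finite form \<Rightarrow> real" where
  "form_norm k \<alpha> =
     sqrt ((\<Sum>I \<in> {I :: 'n list. length I = k}. (\<alpha> (map (\<lambda>i. axis i 1) I))\<^sup>2) / fact k)"


section \<open>The spaces \<open>L\<^sup>p(\<Omega>; \<Lambda>\<^sup>k)\<close> and weak convergence\<close>

text \<open>
  Functions are not identified when they agree almost everywhere, and values outside \<open>\<Omega>\<close> are
  irrelevant.
\<close>

definition Lp_forms :: "(real^'n) set \<Rightarrow> real \<Rightarrow> nat \<Rightarrow> (real^'n \<Rightarrow> 'n::finite form) set" where
  "Lp_forms \<Omega> p k = {\<omega>.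
     (\<forall>x\<in>\<Omega>. \<omega> x \<in> alternating_forms k) \<and>
     (\<forall>vs. (\<lambda>x. \<omega> x vs) \<in> borel_measurable (lebesgue_on \<Omega>)) \<and>
     integrable (lebesgue_on \<Omega>) (\<lambda>x. form_norm k (\<omega> x) powr p)}"

definition Lp_norm :: "(real^'n) set \<Rightarrow> real \<Rightarrow> nat \<Rightarrow> (real^'n \<Rightarrow> 'n::finite form) \<Rightarrow> real" where
  "Lp_norm \<Omega> p k \<omega> = (LINT x|lebesgue_on \<Omega>. form_norm k (\<omega> x) powr p) powr (1 / p)"

text \<open>
  The dual of \<open>L\<^sup>p(\<Omega>; \<Lambda>\<^sup>k)\<close>. Linearity and boundedness by the norm force such a functional to take
  equal values on functions that agree almost everywhere on \<open>\<Omega>\<close>.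
\<close>

definition Lp_dual ::
  "(real^'n) set \<Rightarrow> real \<Rightarrow> nat \<Rightarrow> ((real^'n \<Rightarrow> 'n::finite form) \<Rightarrow> real) set" where
  "Lp_dual \<Omega> p k = {T.
     (\<forall>u\<in>Lp_forms \<Omega> p k. \<forall>v\<in>Lp_forms \<Omega> p k. T (\<lambda>x vs. u x vs + v x vs) = T u + T v) \<and>
     (\<forall>c. \<forall>u\<in>Lp_forms \<Omega> p k. T (\<lambda>x vs. c * u x vs) = c * T u) \<and>
     (\<exists>C. \<forall>u\<in>Lp_forms \<Omega> p k. \<bar>T u\<bar> \<le> C * Lp_norm \<Omega> p k u)}"

definition Lp_weakly_converges ::
  "(real^'n) set \<Rightarrow> real \<Rightarrow> nat \<Rightarrow>
    (nat \<Rightarrow> real^'n \<Rightarrow> 'n::finite form) \<Rightarrow> (real^'n \<Rightarrow> 'n form) \<Rightarrow> bool" where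
  "Lp_weakly_converges \<Omega> p k us u \<longleftrightarrow> (\<forall>T\<in>Lp_dual \<Omega> p k. (\<lambda>\<nu>. T (us \<nu>)) \<longlonglongrightarrow> T u)"


section \<open>The distributional exterior derivative\<close>

primrec C_k :: "nat \<Rightarrow> (real^'n::finite \<Rightarrow> real) \<Rightarrow> bool" where
  "C_k 0 f \<longleftrightarrow> continuous_on UNIV f"
| "C_k (Suc m) f \<longleftrightarrow>
     (\<forall>x. f differentiable (at x)) \<and> (\<forall>v. C_k m (\<lambda>x. frechet_derivative f (at x) v))"

definition test_function :: "(real^'n::finite) set \<Rightarrow> (real^'n \<Rightarrow> real) \<Rightarrow> bool" where
  "test_function \<Omega> \<phi> \<longleftrightarrow>
     (\<forall>m. C_k m \<phi>) \<and> compact (closure {x. \<phi> x \<noteq> 0}) \<and> closure {x. \<phi> x \<noteq> 0} \<subseteq> \<Omega>"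

definition remove_nth :: "nat \<Rightarrow> 'a list \<Rightarrow> 'a list" where
  "remove_nth i xs = take i xs @ drop (Suc i) xs"

text \<open>
  For a smooth form \<open>\<omega>\<close> of degree \<open>r\<close> and constant vectors \<open>v\<^sub>0, \<dots>, v\<^sub>r\<close>, the value of \<open>d\<omega>\<close> on
  \<open>(v\<^sub>0, \<dots>, v\<^sub>r)\<close> is the sum over \<open>i\<close> of \<open>(-1)\<^sup>i\<close> times the derivative in direction \<open>v\<^sub>i\<close> of the
  function obtained by evaluating \<open>\<omega>\<close> on the remaining vectors. Here these derivatives are taken in
  the sense of distributions on \<open>\<Omega>\<close>.
\<close>

definition has_ext_deriv ::
  "(real^'n) set \<Rightarrow> nat \<Rightarrow> (real^'n \<Rightarrow> 'n::finite form) \<Rightarrow> (real^'n \<Rightarrow> 'n form) \<Rightarrow> bool" where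
  "has_ext_deriv \<Omega> r \<omega> \<eta> \<longleftrightarrow>
     (\<forall>\<phi> vs. test_function \<Omega> \<phi> \<and> length vs = Suc r \<longrightarrow>
        (LINT x|lebesgue_on \<Omega>. \<eta> x vs * \<phi> x) =
        - (\<Sum>i\<le>r. (-1) ^ i *
             (LINT x|lebesgue_on \<Omega>.
                \<omega> x (remove_nth i vs) * frechet_derivative \<phi> (at x) (vs ! i))))"

definition Wdp :: "(real^'n) set \<Rightarrow> real \<Rightarrow> nat \<Rightarrow> (real^'n \<Rightarrow> 'n::finite form) set" where
  "Wdp \<Omega> p r = {\<omega> \<in> Lp_forms \<Omega> p r. \<exists>\<eta>\<in>Lp_forms \<Omega> p (Suc r). has_ext_deriv \<Omega> r \<omega> \<eta>}"

text \<open>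
  A representative of \<open>d\<omega>\<close> for \<open>\<omega>\<close> in \<open>Wdp \<Omega> p r\<close>; it is unique up to equality almost everywhere
  on \<open>\<Omega>\<close>.
\<close>

definition ext_deriv ::
  "(real^'n) set \<Rightarrow> real \<Rightarrow> nat \<Rightarrow> (real^'n \<Rightarrow> 'n::finite form) \<Rightarrow> (real^'n \<Rightarrow> 'n form)" where
  "ext_deriv \<Omega> p r \<omega> = (SOME \<eta>. \<eta> \<in> Lp_forms \<Omega> p (Suc r) \<and> has_ext_deriv \<Omega> r \<omega> \<eta>)"

definition Wdp_weakly_converges ::
  "(real^'n) set \<Rightarrow> real \<Rightarrow> nat \<Rightarrow>
    (nat \<Rightarrow> real^'n \<Rightarrow> 'n::finite form) \<Rightarrow> (real^'n \<Rightarrow> 'n form) \<Rightarrow> bool" where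
  "Wdp_weakly_converges \<Omega> p r \<omega>s \<omega> \<longleftrightarrow>
     Lp_weakly_converges \<Omega> p r \<omega>s \<omega> \<and>
     Lp_weakly_converges \<Omega> p (Suc r) (\<lambda>\<nu>. ext_deriv \<Omega> p r (\<omega>s \<nu>)) (ext_deriv \<Omega> p r \<omega>)"

definition seq_weakly_lsc ::
  "(real^'n) set \<Rightarrow> real \<Rightarrow> nat \<Rightarrow> ((real^'n \<Rightarrow> 'n::finite form) \<Rightarrow> real) \<Rightarrow> bool" where
  "seq_weakly_lsc \<Omega> p r F \<longleftrightarrow>
     (\<forall>\<omega>s \<omega>. (\<forall>\<nu>. \<omega>s \<nu> \<in> Wdp \<Omega> p r) \<and> \<omega> \<in> Wdp \<Omega> p r \<and> Wdp_weakly_converges \<Omega> p r \<omega>s \<omega> \<longrightarrow>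
        ereal (F \<omega>) \<le> liminf (\<lambda>\<nu>. ereal (F (\<omega>s \<nu>))))"

end

theory Submission
  imports "Jordan_Normal_Form.Determinant" Defs
begin

text \<open>
  With \<open>g\<^sub>\<nu>(t) = sin (\<nu> t + \<theta>\<^sub>\<nu>)\<close> the forms \<open>\<omega>\<^sub>\<nu> = g\<^sub>\<nu>(x\<^sub>1) dx\<^sub>1 \<and> \<dots> \<and> dx\<^sub>k\<^sub>-\<^sub>1\<close> are closed, because
  \<open>dx\<^sub>1\<close> already occurs in them, so only the term \<open>-|\<omega>|\<^sup>p\<close> of the functional sees the oscillation.
  They converge weakly to \<open>0\<close> because the \<open>g\<^sub>\<nu>\<close> are bounded and orthogonal on a large cube. Since
  \<open>max (|sin t|) (|cos t|) \<ge> 1/2\<close>, one of the phases \<open>0\<close> and \<open>\<pi>/2\<close> keeps the integral of \<open>|\<omega>\<^sub>\<nu>|\<^sup>p\<close> away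
  from \<open>0\<close>, so the functional drops strictly below its value at the weak limit.
\<close>

section \<open>Coordinate forms\<close>

text \<open>This is the form \<open>dx_(e 0) \<and> ... \<and> dx_(e (r - 1))\<close>, as the
  determinant of the chosen coordinates of the arguments. The value \<open>0\<close> on other
  lengths follows the convention of \<open>alternating_forms\<close>.\<close>

definition coord_form :: "(nat \<Rightarrow> 'n) \<Rightarrow> nat \<Rightarrow> 'n::finite form" where
  "coord_form e r vs =
     (if length vs = r then Determinant.det (Matrix.mat r r (\<lambda>(i, j). vec_nth (vs ! i) (e j))) else 0)"

text \<open>Expansion along row \<open>i\<close> gives linearity in slot \<open>i\<close>, because
  its cofactors do not see the entries of that row. Equal arguments give equal rows and hence
  determinant \<open>0\<close>.\<close>

lemma coord_form_alternating: "coord_form e r \<in> alternating_forms r"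
proof -
  have lin: "linear (\<lambda>v. coord_form e r (vs[i := v]))" if vs: "length vs = r" "i < r" for vs and i
  proof -
    let ?B = "Matrix.mat r r (\<lambda>(i, j). vec_nth (vs ! i) (e j))"
    have "coord_form e r (vs[i := v]) = (\<Sum>j<r. vec_nth v (e j) * cofactor ?B i j)" for v
    proof -
      let ?A = "Matrix.mat r r (\<lambda>(a, j). vec_nth (vs[i := v] ! a) (e j))"
      have "mat_delete ?A i j = mat_delete ?B i j" if "j < r" for j
        unfolding mat_delete_def using vs that by (intro eq_matI) auto
      then have "cofactor ?A i j = cofactor ?B i j" if "j < r" for j
        using that by (simp add: cofactor_def)
      moreover have "Determinant.det ?A = (\<Sum>j<r. ?A $$ (i, j) * cofactor ?A i j)"
        using vs by (intro laplace_expansion_row) auto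
      ultimately show ?thesis
        using vs by (simp add: coord_form_def)
    qed
    then show ?thesis
      by (auto simp: linear_iff sum.distrib algebra_simps sum_distrib_left)
  qed
  have alt: "coord_form e r vs = 0" if "length vs = r" "i < j" "j < r" "vs ! i = vs ! j" for vs i j
    unfolding coord_form_def using that
    by (auto intro!: Determinant.det_identical_rows[of _ r i j] eq_vecI)
  show ?thesis
    using lin alt by (auto simp: alternating_forms_def) (simp add: coord_form_def)
qed

lemma coord_form_axes:
  fixes e :: "nat \<Rightarrow> 'n::finite"
  assumes "inj_on e {..<r}"
  shows "coord_form e r (map (\<lambda>i. axis i 1) (map e [0..<r])) = 1"
proof -
  have "Matrix.mat r r (\<lambda>(i, j). vec_nth (map (\<lambda>i. axis i 1) (map e [0..<r]) ! i) (e j)) =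
      (1\<^sub>m r :: real Matrix.mat)"
    using assms by (intro eq_matI) (auto simp: axis_def inj_on_def)
  then show ?thesis
    unfolding coord_form_def by (simp del: map_map)
qed

text \<open>The expansion along the first column of a determinant whose first two columns agree.\<close>

lemma coord_form_wedge_first:
  fixes e :: "nat \<Rightarrow> 'n::finite"
  assumes "1 \<le> r" and vs: "length vs = Suc r"
  shows "(\<Sum>i\<le>r. (-1) ^ i * coord_form e r (remove_nth i vs) * vec_nth (vs ! i) (e 0)) = 0"
proof -
  \<comment> \<open>Truncated subtraction makes \<open>j - 1\<close> equal to \<open>0\<close> for
    both \<open>j = 0\<close> and \<open>j = 1\<close>, so these two columns agree;
    \<open>1 \<le> r\<close> ensures that column \<open>1\<close> exists.\<close>
  let ?A = "Matrix.mat (Suc r) (Suc r) (\<lambda>(i, j). vec_nth (vs ! i) (e (j - 1)))"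
  have "Determinant.det ?A = 0"
    using assms by (intro Determinant.det_identical_columns[of _ "Suc r" 0 1]) (auto intro!: eq_vecI)
  moreover have "Determinant.det ?A = (\<Sum>i<Suc r. ?A $$ (i, 0) * cofactor ?A i 0)"
    by (intro laplace_expansion_column) auto
  moreover have "cofactor ?A i 0 = (-1) ^ i * coord_form e r (remove_nth i vs)" if "i \<le> r" for i
  proof -
    \<comment> \<open>Deleting column \<open>0\<close> shifts the column index up by one, which
      undoes the \<open>j - 1\<close> and leaves the matrix of \<open>coord_form\<close> on the
      remaining vectors.\<close>
    have "mat_delete ?A i 0 = Matrix.mat r r (\<lambda>(a, j). vec_nth (remove_nth i vs ! a) (e j))"
      unfolding mat_delete_def remove_nth_def using vs that
      by (intro eq_matI) (auto simp: nth_append min_def)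
    moreover have "length (remove_nth i vs) = r"
      using vs that by (simp add: remove_nth_def)
    ultimately show ?thesis
      by (simp add: cofactor_def coord_form_def)
  qed
  ultimately show ?thesis
    by (simp add: lessThan_Suc_atMost mult_ac)
qed

section \<open>The Euclidean norm of scaled and coordinate forms\<close>

lemma form_norm_scale: "form_norm k (\<lambda>vs. c * \<alpha> vs) = \<bar>c\<bar> * form_norm k \<alpha>"
  by (simp add: form_norm_def power_mult_distrib real_sqrt_mult
      flip: sum_distrib_left times_divide_eq_right)

lemma form_norm_nonneg: "0 \<le> form_norm k \<alpha>"
  by (simp add: form_norm_def sum_nonneg)

text \<open>The multi-index \<open>map e [0..<r]\<close> alone contributes \<open>1\<close> to a sum
  of squares. Positivity makes the final drop of the functional strict.\<close>

lemma form_norm_coord_form_pos: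
  fixes e :: "nat \<Rightarrow> 'n::finite"
  assumes "inj_on e {..<r}"
  shows "0 < form_norm r (coord_form e r)"
proof -
  have "finite {I :: 'n list. length I = r}"
    using finite_lists_length_eq[of "UNIV :: 'n set" r] by simp
  then have "0 < (\<Sum>I\<in>{I :: 'n list. length I = r}. (coord_form e r (map (\<lambda>i. axis i 1) I))\<^sup>2)"
    by (rule sum_pos2[where i = "map e [0..<r]"]) (use coord_form_axes[OF assms] in auto)
  then show ?thesis
    by (simp add: form_norm_def)
qed

section \<open>Closedness\<close>

lemma test_function_differentiable:
  assumes "test_function \<Omega> \<phi>"
  shows "(\<phi> has_derivative frechet_derivative \<phi> (at x)) (at x)"
proof -
  have "C_k (Suc 0) \<phi>"
    using assms unfolding test_function_def by blast
  then show ?thesis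
    by (simp flip: frechet_derivative_works)
qed

lemma test_function_continuous_derivative:
  assumes "test_function \<Omega> \<phi>"
  shows "continuous_on UNIV (\<lambda>x. frechet_derivative \<phi> (at x) v)"
proof -
  have "C_k (Suc 0) \<phi>"
    using assms unfolding test_function_def by blast
  then show ?thesis
    by simp
qed

lemma test_function_derivative_support:
  assumes "x \<notin> closure {x. \<phi> x \<noteq> 0}"
  shows "frechet_derivative \<phi> (at x) v = 0"
proof -
  have "(\<phi> has_derivative (\<lambda>_. 0)) (at x)"
  proof (rule has_derivative_transform_within_open)
    show "((\<lambda>_. 0) has_derivative (\<lambda>_. 0)) (at x)"
      by simp
    show "open (- closure {x. \<phi> x \<noteq> 0})" "x \<in> - closure {x. \<phi> x \<noteq> 0}"
      using assms by auto
    show "0 = \<phi> y" if "y \<in> - closure {x. \<phi> x \<noteq> 0}" for y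
      using that closure_subset[of "{x. \<phi> x \<noteq> 0}"] by auto
  qed
  then show ?thesis
    by (simp flip: frechet_derivative_at)
qed

section \<open>Compactly supported integrands and translation\<close>

lemma integrable_compact_support:
  fixes f :: "'a::euclidean_space \<Rightarrow> real"
  assumes "continuous_on UNIV f" "compact K" "\<And>x. x \<notin> K \<Longrightarrow> f x = 0"
  shows "integrable lborel f"
proof -
  have "integrable lborel (\<lambda>x. indicator K x *\<^sub>R f x)"
    using assms by (intro borel_integrable_compact) (auto intro: continuous_on_subset)
  moreover have "(\<lambda>x. indicator K x *\<^sub>R f x) = f"
    using assms(3) by (fastforce simp: indicator_def)
  ultimately show ?thesis
    by simp
qed

text \<open>Passes from integrals over \<open>\<Omega>\<close> to integrals over the whole space,
  where translation invariance is available.\<close>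

lemma lebesgue_on_compact_support:
  fixes f :: "'a::euclidean_space \<Rightarrow> real"
  assumes "continuous_on UNIV f" "compact K" "\<And>x. x \<notin> K \<Longrightarrow> f x = 0" "K \<subseteq> \<Omega>" "open \<Omega>"
  shows "integrable (lebesgue_on \<Omega>) f" and "(LINT x|lebesgue_on \<Omega>. f x) = (LBINT x. f x)"
proof -
  have eq: "(\<lambda>x. indicator \<Omega> x * f x) = f"
    using assms(3,4) by (fastforce simp: indicator_def)
  have int: "integrable lborel f"
    using assms(1-3) by (rule integrable_compact_support)
  have \<Omega>: "\<Omega> \<inter> space lebesgue \<in> sets lebesgue"
    using assms(5) by simp
  show "integrable (lebesgue_on \<Omega>) f"
    using int by (simp add: integrable_restrict_space[OF \<Omega>] eq integrable_completion)
  show "(LINT x|lebesgue_on \<Omega>. f x) = (LBINT x. f x)"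
    using int by (simp add: integral_restrict_space[OF \<Omega>] eq integral_completion)
qed

lemma lborel_integral_translation:
  fixes f :: "'a::euclidean_space \<Rightarrow> real"
  assumes "f \<in> borel_measurable borel"
  shows "(LBINT x. f (x + a)) = (LBINT x. f x)"
proof -
  have "(LBINT x. f x) = integral\<^sup>L (distr lborel borel ((+) a)) f"
    by (simp add: lborel_distr_plus)
  also have "\<dots> = (LBINT x. f (x + a))"
    using assms by (subst integral_distr) (auto simp: add.commute)
  finally show ?thesis ..
qed

text \<open>As \<open>g\<close> is only continuous, difference quotients of \<open>\<phi>\<close>
  along \<open>w\<close> replace integration by parts. Each integrates against \<open>g\<close> to
  \<open>0\<close>, since \<open>g\<close> is constant along \<open>w\<close> and Lebesgue measure
  is translation invariant; dominated convergence carries this to the derivative.\<close>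

lemma integral_invariant_times_derivative:
  fixes \<phi> g :: "real^'n::finite \<Rightarrow> real"
  assumes \<phi>: "test_function \<Omega> \<phi>" and g: "continuous_on UNIV g"
    and inv: "\<And>x t. g (x + t *\<^sub>R w) = g x"
  shows "(LBINT x. g x * frechet_derivative \<phi> (at x) w) = 0"
proof -
  let ?K = "closure {x. \<phi> x \<noteq> 0}"
  let ?D = "\<lambda>x. frechet_derivative \<phi> (at x) w"
  define h where "h n = inverse (real (Suc n))" for n
  define q where "q n x = (\<phi> (x + h n *\<^sub>R w) - \<phi> x) / h n" for n x
  have h: "0 < h n" "h n \<le> 1" for n
    by (auto simp: h_def inverse_le_1_iff)
  have h0: "h \<longlonglongrightarrow> 0"
    unfolding h_def by (rule LIMSEQ_inverse_real_of_nat)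
  have K: "compact ?K"
    using \<phi> by (simp add: test_function_def)
  have contD: "continuous_on UNIV ?D"
    using \<phi> by (rule test_function_continuous_derivative)
  have D0: "?D x = 0" if "x \<notin> ?K" for x
    using that by (rule test_function_derivative_support)
  have cont: "continuous_on UNIV \<phi>"
    using test_function_differentiable[OF \<phi>] has_derivative_continuous
    by (metis continuous_at_imp_continuous_on)
  \<comment> \<open>The mean value theorem turns the quotient into a nearby value of the derivative.
    This yields both the pointwise limit, by continuity of \<open>?D\<close>, and a bound uniform in
    \<open>n\<close>.\<close>
  have "\<exists>z. 0 < z \<and> z < h n \<and> q n x = ?D (x + z *\<^sub>R w)" for n x
  proof -
    have "((\<lambda>t. \<phi> (x + t *\<^sub>R w)) has_real_derivative ?D (x + t *\<^sub>R w)) (at t)" for t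
    proof -
      have "((\<lambda>t. x + t *\<^sub>R w) has_derivative (\<lambda>s. s *\<^sub>R w)) (at t)"
        by (auto intro!: derivative_eq_intros)
      from has_derivative_compose[OF this test_function_differentiable[OF \<phi>]]
      have "((\<lambda>t. \<phi> (x + t *\<^sub>R w)) has_derivative
          (\<lambda>s. frechet_derivative \<phi> (at (x + t *\<^sub>R w)) (s *\<^sub>R w))) (at t)" .
      moreover have "frechet_derivative \<phi> (at (x + t *\<^sub>R w)) (s *\<^sub>R w) = ?D (x + t *\<^sub>R w) * s" for s
        using linear_scale[OF has_derivative_linear[OF test_function_differentiable[OF \<phi>]]]
        by (simp add: mult.commute)
      ultimately show ?thesis
        by (simp add: has_field_derivative_def)
    qed
    from MVT2[OF h(1)[of n] this]
    obtain z where z: "0 < z" "z < h n" "\<phi> (x + h n *\<^sub>R w) - \<phi> x = h n * ?D (x + z *\<^sub>R w)"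
      by auto
    then show ?thesis
      using h(1)[of n] by (intro exI[of _ z]) (simp add: q_def)
  qed
  then obtain z where z: "\<And>n x. 0 < z n x" "\<And>n x. z n x < h n" "\<And>n x. q n x = ?D (x + z n x *\<^sub>R w)"
    by metis
  have "(\<lambda>n. q n x) \<longlonglongrightarrow> ?D x" for x
  proof -
    have "(\<lambda>n. z n x) \<longlonglongrightarrow> 0"
      by (rule tendsto_sandwich[OF _ _ tendsto_const h0]) (use z in \<open>auto simp: less_imp_le\<close>)
    then have "(\<lambda>n. x + z n x *\<^sub>R w) \<longlonglongrightarrow> x + 0 *\<^sub>R w"
      by (intro tendsto_intros)
    then have "(\<lambda>n. ?D (x + z n x *\<^sub>R w)) \<longlonglongrightarrow> ?D x"
      using continuous_on_tendsto_compose[OF contD, of "\<lambda>n. x + z n x *\<^sub>R w" x sequentially] by simp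
    then show ?thesis
      by (simp add: z(3))
  qed
  then have lim: "(\<lambda>n. g x * q n x) \<longlonglongrightarrow> g x * ?D x" for x
    by (intro tendsto_intros)
  obtain M where M: "\<And>x. x \<in> ?K \<Longrightarrow> norm (?D x) \<le> M"
    using compact_imp_bounded[OF compact_continuous_image[OF continuous_on_subset[OF contD] K]]
    unfolding bounded_iff by auto
  obtain R where R: "\<And>x. x \<in> ?K \<Longrightarrow> norm x \<le> R"
    using compact_imp_bounded[OF K] unfolding bounded_iff by auto
  \<comment> \<open>A nonzero quotient forces \<open>x + z n x *\<^sub>R w\<close> into the support,
    and \<open>z n x < h n \<le> 1\<close>, so \<open>x\<close> is within \<open>norm w\<close> of
    the support.\<close>
  let ?B = "cball 0 (R + norm w)"
  have dom: "norm (g x * q n x) \<le> indicator ?B x *\<^sub>R (\<bar>M\<bar> * \<bar>g x\<bar>)" for n x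
  proof (cases "x + z n x *\<^sub>R w \<in> ?K")
    case True
    have "norm x \<le> norm (x + z n x *\<^sub>R w) + norm (z n x *\<^sub>R w)"
      by (metis add_diff_cancel_right' norm_triangle_ineq4)
    moreover have "norm (z n x *\<^sub>R w) \<le> norm w"
      using z(1,2)[of n x] h[of n] by (simp add: mult_left_le_one_le)
    ultimately have "x \<in> ?B"
      using R[OF True] by simp
    moreover have "\<bar>q n x\<bar> \<le> \<bar>M\<bar>"
      using M[OF True] by (simp add: z(3))
    ultimately show ?thesis
      by (simp add: abs_mult mult.commute[of "\<bar>M\<bar>"] mult_left_mono)
  next
    case False
    then show ?thesis
      by (simp add: z(3) D0 indicator_def)
  qed
  have meas [measurable]: "\<phi> \<in> borel_measurable borel" "g \<in> borel_measurable borel"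
      "?D \<in> borel_measurable borel"
    using cont g contD by (auto intro: borel_measurable_continuous_onI)
  have [measurable]: "q n \<in> borel_measurable borel" for n
    unfolding q_def[abs_def] by measurable
  have "integrable lborel (\<lambda>x. indicator ?B x *\<^sub>R (\<bar>M\<bar> * \<bar>g x\<bar>))"
    by (rule borel_integrable_compact) (auto intro!: continuous_intros continuous_on_subset[OF g])
  then have "(\<lambda>n. LBINT x. g x * q n x) \<longlonglongrightarrow> (LBINT x. g x * ?D x)"
    by (rule integral_dominated_convergence[rotated 2]) (use lim dom in auto)
  moreover have "(LBINT x. g x * q n x) = 0" for n
  proof -
    let ?f = "\<lambda>x. g x * \<phi> x"
    have f0: "?f x = 0" if "x \<notin> ?K" for x
      using that closure_subset[of "{x. \<phi> x \<noteq> 0}"] by auto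
    have int: "integrable lborel ?f"
      by (rule integrable_compact_support[OF _ K f0]) (intro continuous_intros g cont)
    have int': "integrable lborel (\<lambda>x. ?f (x + h n *\<^sub>R w))"
    proof (rule integrable_compact_support)
      show "continuous_on UNIV (\<lambda>x. ?f (x + h n *\<^sub>R w))"
        by (intro continuous_intros continuous_on_compose2[OF g] continuous_on_compose2[OF cont]) auto
      show "compact ((\<lambda>x. x - h n *\<^sub>R w) ` ?K)"
        using K by (intro compact_continuous_image) (intro continuous_intros)
      show "?f (x + h n *\<^sub>R w) = 0" if "x \<notin> (\<lambda>x. x - h n *\<^sub>R w) ` ?K" for x
        using that by (intro f0) (metis add_diff_cancel_right' imageI)
    qed
    \<comment> \<open>By \<open>inv\<close>, \<open>g x\<close> may be replaced by
      \<open>g (x + h n *\<^sub>R w)\<close>, so the quotient becomes a difference of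
      \<open>?f\<close> and its own translate.\<close>
    have "(LBINT x. g x * q n x) = (LBINT x. (?f (x + h n *\<^sub>R w) - ?f x) / h n)"
      by (intro Bochner_Integration.integral_cong) (simp_all add: q_def inv algebra_simps diff_divide_distrib)
    also have "\<dots> = ((LBINT x. ?f (x + h n *\<^sub>R w)) - (LBINT x. ?f x)) / h n"
      using int int' by simp
    also have "(LBINT x. ?f (x + h n *\<^sub>R w)) = (LBINT x. ?f x)"
      by (rule lborel_integral_translation) measurable
    finally show ?thesis
      by simp
  qed
  ultimately show ?thesis
    by (simp add: LIMSEQ_const_iff)
qed

text \<open>All directional derivatives combine into one, in a direction \<open>w\<close> whose
  \<open>e 0\<close> component is \<open>0\<close> because \<open>dx_(e 0)\<close> wedged with the
  coordinate form vanishes. The profile is constant along \<open>w\<close>, so the right-hand side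
  of \<open>has_ext_deriv\<close> vanishes. The resulting condition on \<open>\<eta>\<close> is the
  same for every \<open>g\<close>.\<close>

lemma has_ext_deriv_oscillation_iff:
  fixes \<Omega> :: "(real^'n::finite) set"
  assumes "open \<Omega>" "1 \<le> r" and g: "continuous_on UNIV (g :: real \<Rightarrow> real)"
  shows "has_ext_deriv \<Omega> r (\<lambda>x vs. g (vec_nth x (e 0)) * coord_form e r vs) \<eta> \<longleftrightarrow>
    (\<forall>\<phi> vs. test_function \<Omega> \<phi> \<and> length vs = Suc r \<longrightarrow>
      (LINT x|lebesgue_on \<Omega>. \<eta> x vs * \<phi> x) = 0)"
proof -
  have "(\<Sum>i\<le>r. (-1) ^ i * (LINT x|lebesgue_on \<Omega>. g (vec_nth x (e 0)) * coord_form e r (remove_nth i vs)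
      * frechet_derivative \<phi> (at x) (vs ! i))) = 0"
    if \<phi>: "test_function \<Omega> \<phi>" and vs: "length vs = Suc r" for \<phi> vs
  proof -
    let ?G = "\<lambda>x::real^'n. g (vec_nth x (e 0))"
    let ?a = "\<lambda>i. (-1) ^ i * coord_form e r (remove_nth i vs)"
    let ?K = "closure {x. \<phi> x \<noteq> 0}"
    define w where "w = (\<Sum>i\<le>r. ?a i *\<^sub>R vs ! i)"
    have K: "compact ?K" "?K \<subseteq> \<Omega>"
      using \<phi> by (auto simp: test_function_def)
    have G: "continuous_on UNIV ?G"
      by (intro continuous_on_compose2[OF g] continuous_intros) auto
    have cont: "continuous_on UNIV (\<lambda>x. ?G x * frechet_derivative \<phi> (at x) v)" for v
      by (intro continuous_intros G test_function_continuous_derivative[OF \<phi>])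
    have supp: "?G x * frechet_derivative \<phi> (at x) v = 0" if "x \<notin> ?K" for x v
      using test_function_derivative_support[OF that] by simp
    note lebesgue = lebesgue_on_compact_support[OF cont K(1) supp K(2) \<open>open \<Omega>\<close>]
    have "(\<Sum>i\<le>r. (-1) ^ i * (LINT x|lebesgue_on \<Omega>. ?G x * coord_form e r (remove_nth i vs)
        * frechet_derivative \<phi> (at x) (vs ! i))) =
      (\<Sum>i\<le>r. LINT x|lebesgue_on \<Omega>. ?a i * (?G x * frechet_derivative \<phi> (at x) (vs ! i)))"
      by (simp add: mult_ac flip: integral_mult_right_zero)
    also have "\<dots> = (LINT x|lebesgue_on \<Omega>. (\<Sum>i\<le>r. ?a i * (?G x * frechet_derivative \<phi> (at x) (vs ! i))))"
      by (intro Bochner_Integration.integral_sum[symmetric] integrable_mult_right lebesgue(1))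
    also have "\<dots> = (LINT x|lebesgue_on \<Omega>. ?G x * frechet_derivative \<phi> (at x) w)"
    proof (intro Bochner_Integration.integral_cong refl)
      fix x
      have "linear (frechet_derivative \<phi> (at x))"
        using has_derivative_linear[OF test_function_differentiable[OF \<phi>]] .
      then show "(\<Sum>i\<le>r. ?a i * (?G x * frechet_derivative \<phi> (at x) (vs ! i))) =
          ?G x * frechet_derivative \<phi> (at x) w"
        by (simp add: w_def linear_sum linear_scale sum_distrib_left mult_ac)
    qed
    also have "\<dots> = (LBINT x. ?G x * frechet_derivative \<phi> (at x) w)"
      by (rule lebesgue(2))
    also have "\<dots> = 0"
    proof (rule integral_invariant_times_derivative[OF \<phi> G])
      have "vec_nth w (e 0) = 0"
        using coord_form_wedge_first[OF \<open>1 \<le> r\<close> vs, of e] by (simp add: w_def)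
      then show "?G (x + t *\<^sub>R w) = ?G x" for x t
        by simp
    qed
    finally show ?thesis .
  qed
  then show ?thesis
    by (simp add: has_ext_deriv_def)
qed

section \<open>Oscillations on cubes\<close>

lemma integrable_lebesgue_on_compact:
  fixes f :: "'a::euclidean_space \<Rightarrow> real"
  assumes "compact Q" "continuous_on Q f"
  shows "integrable (lebesgue_on Q) f"
proof -
  have "integrable lebesgue (\<lambda>x. indicator Q x *\<^sub>R f x)"
    using borel_integrable_compact[OF assms] by (simp add: integrable_completion)
  then show ?thesis
    using assms(1) by (subst integrable_restrict_space) (auto simp: lmeasurable_compact fmeasurableD)
qed

text \<open>Fubini for products of one-variable functions: \<open>lborel\<close> is the image of a
  product of one-dimensional Lebesgue measures.\<close>

lemma lborel_integral_prod:
  fixes f :: "'a::euclidean_space \<Rightarrow> real \<Rightarrow> real"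
  assumes "\<And>b. b \<in> Basis \<Longrightarrow> integrable lborel (f b)"
  shows "integral\<^sup>L lborel (\<lambda>x::'a. \<Prod>b\<in>Basis. f b (x \<bullet> b)) = (\<Prod>b\<in>Basis. integral\<^sup>L lborel (f b))"
proof -
  interpret product_sigma_finite "\<lambda>_::'a. lborel :: real measure" ..
  have [measurable]: "b \<in> Basis \<Longrightarrow> f b \<in> borel_measurable borel" for b
    using borel_measurable_integrable[OF assms] by simp
  have "integral\<^sup>L lborel (\<lambda>x::'a. \<Prod>b\<in>Basis. f b (x \<bullet> b)) =
    integral\<^sup>L (\<Pi>\<^sub>M b\<in>Basis. lborel) (\<lambda>x. \<Prod>b\<in>Basis. f b ((\<Sum>c\<in>Basis. x c *\<^sub>R c) \<bullet> (b::'a)))"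
    by (subst lborel_eq) (simp add: integral_distr)
  also have "\<dots> = integral\<^sup>L (\<Pi>\<^sub>M b\<in>Basis. lborel) (\<lambda>x. \<Prod>b\<in>Basis. f b (x (b::'a)))"
    by (intro Bochner_Integration.integral_cong prod.cong) (auto simp: inner_sum_left inner_Basis if_distrib cong: if_cong)
  also have "\<dots> = (\<Prod>b\<in>Basis. integral\<^sup>L lborel (f b))"
    by (rule product_integral_prod) (use assms in auto)
  finally show ?thesis .
qed

text \<open>The sides have length \<open>2 * M * pi\<close>, a whole number of periods of every wave
  with integer frequency.\<close>

definition pi_cube :: "nat \<Rightarrow> (real^'n::finite) set" where
  "pi_cube M = {x. \<forall>i. \<bar>vec_nth x i\<bar> \<le> M * pi}"

lemma pi_cube_cbox: "pi_cube M = cbox (\<chi> i. - (M * pi)) (\<chi> i. M * pi)"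
  unfolding pi_cube_def mem_box_cart abs_le_iff set_eq_iff mem_Collect_eq vec_lambda_beta
  by (simp add: minus_le_iff conj_commute)

lemma has_integral_cos_period:
  fixes m :: int and M :: nat
  assumes "m \<noteq> 0"
  shows "((\<lambda>t. cos (m * t + c)) has_integral 0) {- (M * pi)..M * pi}"
proof -
  let ?F = "\<lambda>t::real. sin (m * t + c) / m"
  have "((\<lambda>t. cos (m * t + c)) has_integral ?F (M * pi) - ?F (- (M * pi))) {- (M * pi)..M * pi}"
    by (rule fundamental_theorem_of_calculus)
       (use assms in \<open>auto intro!: derivative_eq_intros simp flip: has_real_derivative_iff_has_vector_derivative\<close>)
  moreover have "sin (m * (M * pi) + c) = sin (m * (- (M * pi)) + c)"
  proof -
    have "sin (m * (M * pi)) = 0"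
      using sin_npi_int[of "m * int M"] by (simp add: mult_ac)
    then show ?thesis
      by (simp add: sin_add sin_diff)
  qed
  ultimately show ?thesis
    by simp
qed

text \<open>The cube is a product of intervals and the wave depends on one coordinate, so the
  integral factors; the factor of coordinate \<open>i\<close> runs over whole periods and is
  \<open>0\<close>.\<close>

lemma integral_cos_pi_cube:
  fixes m :: int
  assumes "m \<noteq> 0"
  shows "(LINT x|lebesgue_on (pi_cube M :: (real^'n::finite) set). cos (m * vec_nth x i + c)) = 0"
proof -
  let ?J = "{- (M * pi)..M * pi}"
  define f where "f b t = indicator ?J t * (if b = axis i 1 then cos (m * t + c) else 1)"
    for b :: "real^'n" and t :: real
  have int: "integrable lborel (f b)" for b
  proof -
    have "set_integrable lborel ?J (\<lambda>t. if b = axis i 1 then cos (m * t + c) else 1)"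
      by (rule borel_integrable_atLeastAtMost') (cases "b = axis i 1"; simp; intro continuous_intros)
    then show ?thesis
      by (simp add: f_def[abs_def] set_integrable_def)
  qed
  have "integral\<^sup>L lborel (f (axis i 1)) = 0"
  proof -
    have "set_integrable lborel ?J (\<lambda>t. cos (m * t + c))"
      by (rule borel_integrable_atLeastAtMost') (auto intro!: continuous_intros)
    then have "(LINT t:?J|lborel. cos (m * t + c)) = integral ?J (\<lambda>t. cos (m * t + c))"
      by (rule set_borel_integral_eq_integral)
    then show ?thesis
      using has_integral_cos_period[OF assms, of c M]
      by (simp add: f_def[abs_def] set_lebesgue_integral_def integral_unique)
  qed
  then have 0: "(\<Prod>b\<in>Basis. integral\<^sup>L lborel (f b)) = 0"
    by (auto simp: prod_zero_iff intro!: bexI[of _ "axis i 1"])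
  have "(LINT x|lebesgue_on (pi_cube M :: (real^'n) set). cos (m * vec_nth x i + c)) =
    (LINT x|lebesgue. indicator (pi_cube M) x * cos (m * vec_nth x i + c))"
    by (subst integral_restrict_space) (auto simp: pi_cube_cbox)
  also have "\<dots> = (LINT x|lborel. indicator (pi_cube M) x * cos (m * vec_nth x i + c))"
    by (rule integral_completion) (auto simp: pi_cube_cbox)
  also have "\<dots> = (LINT x|lborel. (\<Prod>b\<in>Basis. f b (x \<bullet> b)))"
  proof (rule Bochner_Integration.integral_cong)
    fix x :: "real^'n"
    have "indicator (pi_cube M) x = (\<Prod>b\<in>Basis. indicator ?J (x \<bullet> b) :: real)"
    proof (cases "x \<in> pi_cube M")
      case True
      then have "x \<bullet> b \<in> ?J" if "b \<in> Basis" for b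
        using that unfolding pi_cube_def Basis_vec_def
        by (auto simp: inner_axis abs_le_iff minus_le_iff)
      then show ?thesis
        using True by simp
    next
      case False
      then obtain l where "\<not> \<bar>vec_nth x l\<bar> \<le> M * pi"
        by (auto simp: pi_cube_def)
      then have "\<exists>b\<in>Basis. indicator ?J (x \<bullet> b) = (0::real)"
        by (intro bexI[of _ "axis l 1"]) (auto simp: inner_axis indicator_def abs_le_iff minus_le_iff)
      then show ?thesis
        using False by (simp add: prod_zero_iff)
    qed
    moreover have "(\<Prod>b\<in>Basis. if b = axis i 1 then cos (m * (x \<bullet> b) + c) else 1) = cos (m * vec_nth x i + c)"
      by (simp add: inner_axis)
    ultimately show "indicator (pi_cube M) x * cos (m * vec_nth x i + c) = (\<Prod>b\<in>Basis. f b (x \<bullet> b))"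
      by (simp add: f_def prod.distrib)
  qed simp
  also have "\<dots> = 0"
    using lborel_integral_prod[of f] int 0 by simp
  finally show ?thesis .
qed

text \<open>The product-to-sum formula leaves the frequencies \<open>\<nu> - \<mu>\<close> and
  \<open>\<nu> + \<mu>\<close>, both nonzero for distinct naturals. The difference may be negative,
  hence the integer frequencies. The phases are arbitrary, so they can later be chosen separately
  for each \<open>\<nu>\<close>.\<close>

lemma orthogonal_oscillations:
  fixes \<theta> :: "nat \<Rightarrow> real"
  assumes "\<nu> \<noteq> \<mu>"
  shows "(LINT x|lebesgue_on (pi_cube M :: (real^'n::finite) set).
    sin (real \<nu> * vec_nth x i + \<theta> \<nu>) * sin (real \<mu> * vec_nth x i + \<theta> \<mu>)) = 0"
proof -
  let ?Q = "pi_cube M :: (real^'n) set"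
  let ?c1 = "\<lambda>x::real^'n. cos (real_of_int (int \<nu> - int \<mu>) * vec_nth x i + (\<theta> \<nu> - \<theta> \<mu>))"
  let ?c2 = "\<lambda>x::real^'n. cos (real_of_int (int \<nu> + int \<mu>) * vec_nth x i + (\<theta> \<nu> + \<theta> \<mu>))"
  have "integrable (lebesgue_on ?Q) ?c1" "integrable (lebesgue_on ?Q) ?c2"
    by (auto intro!: integrable_lebesgue_on_compact continuous_intros simp: pi_cube_cbox)
  moreover have "integral\<^sup>L (lebesgue_on ?Q) ?c1 = 0" "integral\<^sup>L (lebesgue_on ?Q) ?c2 = 0"
    using assms by (intro integral_cos_pi_cube; simp)+
  moreover have eq: "sin (real \<nu> * vec_nth x i + \<theta> \<nu>) * sin (real \<mu> * vec_nth x i + \<theta> \<mu>) = (?c1 x - ?c2 x) / 2" for x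
    unfolding sin_times_sin by (simp add: algebra_simps)
  ultimately show ?thesis
    unfolding eq by simp
qed

lemma bounded_subset_pi_cube:
  fixes \<Omega> :: "(real^'n::finite) set"
  assumes "bounded \<Omega>"
  obtains M where "\<Omega> \<subseteq> pi_cube M"
proof -
  obtain B where B: "\<And>x. x \<in> \<Omega> \<Longrightarrow> norm x \<le> B"
    using assms by (auto simp: bounded_iff)
  obtain M :: nat where "B < real M * pi"
    using reals_Archimedean3[OF pi_gt_zero] by blast
  then have "\<bar>vec_nth x i\<bar> \<le> real M * pi" if "x \<in> \<Omega>" for x i
    using B[OF that] component_le_norm_cart[of x i] by linarith
  then show ?thesis
    by (intro that[of M]) (auto simp: pi_cube_def)
qed

text \<open>The integrands for the phases \<open>0\<close> and \<open>pi / 2\<close> add up to at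
  least \<open>(1 / 2) powr p\<close> at each point, so one of the two integrals carries at least
  half of the total. The bound is uniform in the frequency \<open>m\<close>.\<close>

lemma oscillation_phase_lower_bound:
  fixes \<Omega> :: "(real^'n::finite) set"
  assumes \<Omega>: "open \<Omega>" "bounded \<Omega>" and p: "0 < p"
  shows "\<exists>\<theta>. (1 / 2) powr p * measure lebesgue \<Omega> / 2 \<le>
    (LINT x|lebesgue_on \<Omega>. \<bar>sin (m * vec_nth x i + \<theta>)\<bar> powr p)"
proof (rule ccontr)
  let ?I = "\<lambda>\<theta>. LINT x|lebesgue_on \<Omega>. \<bar>sin (m * vec_nth x i + \<theta>)\<bar> powr p"
  let ?b = "(1 / 2) powr p * measure lebesgue \<Omega>"
  assume "\<not> ?thesis"
  then have less: "?I \<theta> < ?b / 2" for \<theta>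
    by (simp add: not_le)
  have "?I 0 < ?b / 2" "?I (pi / 2) < ?b / 2"
    by (rule less)+
  moreover have "?b \<le> ?I 0 + ?I (pi / 2)"
  proof -
    interpret finite_measure "lebesgue_on \<Omega>"
      using \<Omega> by (intro finite_measure_lebesgue_on lmeasurable_open)
    have int: "integrable (lebesgue_on \<Omega>) (\<lambda>x. \<bar>sin (m * vec_nth x i + \<theta>)\<bar> powr p)" for \<theta>
    proof (rule integrable_const_bound[where B = 1])
      have [measurable]: "(\<lambda>x. sin (m * vec_nth x i + \<theta>)) \<in> borel_measurable (lebesgue_on \<Omega>)"
        using \<Omega> by (intro continuous_imp_measurable_on_sets_lebesgue continuous_intros) auto
      show "(\<lambda>x. \<bar>sin (m * vec_nth x i + \<theta>)\<bar> powr p) \<in> borel_measurable (lebesgue_on \<Omega>)"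
        by measurable
      show "AE x in lebesgue_on \<Omega>. norm (\<bar>sin (m * vec_nth x i + \<theta>)\<bar> powr p) \<le> 1"
        using p by (intro AE_I2) (auto intro: powr_le1)
    qed
    have "?b = (LINT x|lebesgue_on \<Omega>. (1 / 2) powr p)"
      using \<Omega> by (simp add: measure_restrict_space)
    also have "\<dots> \<le> (LINT x|lebesgue_on \<Omega>. \<bar>sin (m * vec_nth x i + 0)\<bar> powr p
        + \<bar>sin (m * vec_nth x i + pi / 2)\<bar> powr p)"
    proof (intro integral_mono Bochner_Integration.integrable_add int)
      fix x :: "real^'n"
      let ?t = "m * vec_nth x i"
      have "1 / 2 \<le> \<bar>sin ?t\<bar> \<or> 1 / 2 \<le> \<bar>cos ?t\<bar>"
      proof (rule ccontr)
        assume "\<not> ?thesis"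
        then have "\<bar>sin ?t\<bar>\<^sup>2 < (1 / 2)\<^sup>2" "\<bar>cos ?t\<bar>\<^sup>2 < (1 / 2)\<^sup>2"
          by (intro power_strict_mono; simp)+
        then show False
          using sin_cos_squared_add[of ?t] by (simp add: power2_eq_square)
      qed
      then have "(1 / 2) powr p \<le> \<bar>sin ?t\<bar> powr p \<or> (1 / 2) powr p \<le> \<bar>cos ?t\<bar> powr p"
        using p by (auto intro: powr_mono2)
      moreover have "sin (?t + pi / 2) = cos ?t"
        by (simp add: sin_add)
      ultimately show "(1 / 2) powr p \<le> \<bar>sin (?t + 0)\<bar> powr p + \<bar>sin (?t + pi / 2)\<bar> powr p"
        by (auto intro: add_increasing add_increasing2)
    qed (simp)
    also have "\<dots> = ?I 0 + ?I (pi / 2)"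
      by (rule Bochner_Integration.integral_add[OF int int])
    finally show ?thesis .
  qed
  ultimately show False
    by linarith
qed

section \<open>Weak convergence of bounded orthogonal sequences\<close>

lemma alternating_forms_scale:
  "\<alpha> \<in> alternating_forms k \<Longrightarrow> (\<lambda>vs. c * \<alpha> vs) \<in> alternating_forms k"
  by (auto simp: alternating_forms_def linear_iff algebra_simps)

lemma form_scale_in_Lp_forms:
  fixes h :: "real^'n::finite \<Rightarrow> real"
  assumes "1 \<le> p" and \<Omega>: "open \<Omega>" "bounded \<Omega>" and \<alpha>: "\<alpha> \<in> alternating_forms k"
    and h: "continuous_on UNIV h" and B: "\<And>x. \<bar>h x\<bar> \<le> B"
  shows "(\<lambda>x vs. h x * \<alpha> vs) \<in> Lp_forms \<Omega> p k"
proof -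
  have [measurable]: "h \<in> borel_measurable (lebesgue_on \<Omega>)"
    using \<Omega> by (intro continuous_imp_measurable_on_sets_lebesgue continuous_on_subset[OF h]) auto
  interpret finite_measure "lebesgue_on \<Omega>"
    using \<Omega> by (intro finite_measure_lebesgue_on lmeasurable_open)
  have "integrable (lebesgue_on \<Omega>) (\<lambda>x. (\<bar>h x\<bar> * form_norm k \<alpha>) powr p)"
  proof (rule integrable_const_bound)
    show "AE x in lebesgue_on \<Omega>. norm ((\<bar>h x\<bar> * form_norm k \<alpha>) powr p) \<le> (B * form_norm k \<alpha>) powr p"
      using B \<open>1 \<le> p\<close>
      by (intro AE_I2) (auto intro!: powr_mono2 mult_right_mono mult_nonneg_nonneg form_norm_nonneg)
  qed measurable
  then show ?thesis
    using \<alpha> by (auto simp: Lp_forms_def form_norm_scale alternating_forms_scale)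
qed

text \<open>Orthogonality removes the cross terms, so the square of a sum of \<open>N\<close>
  members integrates to at most \<open>N\<close> times the measure of \<open>Q\<close>, and not
  \<open>N\<close> squared times it. A pointwise arithmetic-geometric mean inequality converts this
  into a bound on the integral of the absolute value.\<close>

lemma integral_abs_signed_sum_le:
  fixes Q :: "(real^'n::finite) set" and g :: "'i \<Rightarrow> real^'n \<Rightarrow> real"
  assumes Q: "compact Q" and F: "finite F" "F \<noteq> {}"
    and g: "\<And>\<nu>. continuous_on UNIV (g \<nu>)" and g1: "\<And>\<nu> x. \<bar>g \<nu> x\<bar> \<le> 1" and a1: "\<And>\<nu>. \<bar>a \<nu>\<bar> \<le> 1"
    and orth: "\<And>\<nu> \<mu>. \<nu> \<noteq> \<mu> \<Longrightarrow> (LINT x|lebesgue_on Q. g \<nu> x * g \<mu> x) = 0"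
  shows "(LINT x|lebesgue_on Q. \<bar>(\<Sum>\<nu>\<in>F. a \<nu> * g \<nu> x) / card F\<bar>) \<le> measure lebesgue Q / sqrt (card F)"
proof -
  let ?N = "real (card F)" and ?q = "measure lebesgue Q"
  define S where "S x = (\<Sum>\<nu>\<in>F. a \<nu> * g \<nu> x)" for x
  have N: "0 < ?N"
    using F by (simp add: card_gt_0_iff)
  have int: "integrable (lebesgue_on Q) f" if "continuous_on UNIV f" for f :: "real^'n \<Rightarrow> real"
    using Q that by (intro integrable_lebesgue_on_compact) (auto intro: continuous_on_subset)
  have S: "continuous_on UNIV S"
    unfolding S_def by (intro continuous_intros g)
  have space: "measure (lebesgue_on Q) Q = ?q"
    using Q by (simp add: measure_restrict_space lmeasurable_compact fmeasurableD)
  have "(LINT x|lebesgue_on Q. S x * S x) =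
      (LINT x|lebesgue_on Q. (\<Sum>\<nu>\<in>F. \<Sum>\<mu>\<in>F. a \<nu> * a \<mu> * (g \<nu> x * g \<mu> x)))"
    by (simp add: S_def sum_product mult_ac)
  also have "\<dots> = (\<Sum>\<nu>\<in>F. \<Sum>\<mu>\<in>F. LINT x|lebesgue_on Q. a \<nu> * a \<mu> * (g \<nu> x * g \<mu> x))"
    by (subst Bochner_Integration.integral_sum; (intro Bochner_Integration.integrable_sum int continuous_intros g)?)
       (intro sum.cong refl Bochner_Integration.integral_sum int continuous_intros g)
  also have "\<dots> = (\<Sum>\<nu>\<in>F. \<Sum>\<mu>\<in>F. if \<nu> = \<mu> then LINT x|lebesgue_on Q. (a \<nu> * g \<nu> x)\<^sup>2 else 0)"
    by (intro sum.cong refl) (auto simp: orth power2_eq_square mult_ac)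
  also have "\<dots> = (\<Sum>\<nu>\<in>F. LINT x|lebesgue_on Q. (a \<nu> * g \<nu> x)\<^sup>2)"
    using F by (simp add: sum.delta')
  also have "\<dots> \<le> (\<Sum>\<nu>\<in>F. LINT x|lebesgue_on Q. 1)"
  proof (intro sum_mono integral_mono int continuous_intros g)
    show "(a \<nu> * g \<nu> x)\<^sup>2 \<le> 1" for \<nu> x
      using mult_mono[OF a1[of \<nu>] g1[of \<nu> x]] by (simp add: abs_square_le_1 abs_mult)
  qed
  also have "\<dots> = ?N * ?q"
    by (simp add: space)
  finally have S2: "(LINT x|lebesgue_on Q. S x * S x) \<le> ?N * ?q" .
  \<comment> \<open>The weights come from
    \<open>2 * \<bar>S x\<bar> * u \<le> u * u + S x * S x\<close> with \<open>u = sqrt ?N\<close>,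
    divided by \<open>2 * u^3\<close>. With this \<open>u\<close> both terms finally contribute at
    most \<open>?q / (2 * sqrt ?N)\<close>.\<close>
  have "(LINT x|lebesgue_on Q. \<bar>S x / ?N\<bar>) \<le>
      (LINT x|lebesgue_on Q. 1 / (2 * sqrt ?N) + 1 / (2 * ?N * sqrt ?N) * (S x * S x))"
  proof (intro integral_mono int continuous_intros S)
    fix x
    define u where "u = sqrt ?N"
    have u: "0 < u" "?N = u * u"
      using N by (auto simp: u_def)
    have "2 * \<bar>S x\<bar> * u \<le> u * u + S x * S x"
      using sum_squares_bound[of "\<bar>S x\<bar>" u] by (simp add: power2_eq_square)
    then show "\<bar>S x / ?N\<bar> \<le> 1 / (2 * sqrt ?N) + 1 / (2 * ?N * sqrt ?N) * (S x * S x)"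
      using u unfolding u_def[symmetric] by (simp add: field_simps)
  qed (use N in auto)
  also have "\<dots> = ?q / (2 * sqrt ?N) + 1 / (2 * ?N * sqrt ?N) * (LINT x|lebesgue_on Q. S x * S x)"
  proof -
    have "(LINT x|lebesgue_on Q. 1 / (2 * sqrt ?N)) = ?q / (2 * sqrt ?N)"
      by (simp add: space)
    then show ?thesis
      by (subst Bochner_Integration.integral_add; (intro int continuous_intros S)?)
         (use N in \<open>simp_all del: integral_const\<close>)
  qed
  also have "\<dots> \<le> ?q / (2 * sqrt ?N) + 1 / (2 * ?N * sqrt ?N) * (?N * ?q)"
    using S2 N by (intro add_left_mono mult_left_mono) auto
  also have "\<dots> = ?q / sqrt ?N"
    using N by (simp add: field_simps)
  finally show ?thesis
    by (simp add: S_def)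
qed

text \<open>For \<open>\<bar>h x\<bar> \<le> 1\<close> and \<open>p \<ge> 1\<close> the power
  \<open>\<bar>h x\<bar> powr p\<close> is at most \<open>\<bar>h x\<bar>\<close>, so smallness in
  the mean over \<open>Q\<close> already controls the \<open>Lp_norm\<close> over
  \<open>\<Omega>\<close>.\<close>

lemma Lp_norm_form_scale_le:
  fixes h :: "real^'n::finite \<Rightarrow> real"
  assumes p: "1 \<le> p" and \<Omega>: "open \<Omega>" "\<Omega> \<subseteq> Q" "compact Q" and \<alpha>: "\<alpha> \<in> alternating_forms k"
    and h: "continuous_on UNIV h" and h1: "\<And>x. \<bar>h x\<bar> \<le> 1"
  shows "Lp_norm \<Omega> p k (\<lambda>x vs. h x * \<alpha> vs) \<le>
    form_norm k \<alpha> * (LINT x|lebesgue_on Q. \<bar>h x\<bar>) powr (1 / p)"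
proof -
  let ?c = "form_norm k \<alpha>"
  have bdd: "bounded \<Omega>"
    using \<Omega> bounded_subset compact_imp_bounded by blast
  have intQ: "integrable (lebesgue_on Q) (\<lambda>x. \<bar>h x\<bar>)"
    using \<Omega>(3) by (intro integrable_lebesgue_on_compact continuous_intros continuous_on_subset[OF h]) auto
  have setQ: "Q \<inter> space lebesgue \<in> sets lebesgue" and set\<Omega>: "\<Omega> \<inter> space lebesgue \<in> sets lebesgue"
    using \<Omega> by (auto simp: lmeasurable_compact fmeasurableD)
  have int\<Omega>: "integrable (lebesgue_on \<Omega>) (\<lambda>x. \<bar>h x\<bar>)"
  proof -
    have "integrable lebesgue (\<lambda>x. indicator \<Omega> x *\<^sub>R (indicator Q x *\<^sub>R \<bar>h x\<bar>))"
      using \<Omega>(1) by (intro integrable_mult_indicator[OF _ iffD1[OF integrable_restrict_space[OF setQ] intQ]]) auto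
    moreover have "indicator \<Omega> x *\<^sub>R (indicator Q x *\<^sub>R \<bar>h x\<bar>) = indicator \<Omega> x *\<^sub>R \<bar>h x\<bar>" for x
      using \<Omega>(2) by (auto simp: indicator_def)
    ultimately show ?thesis
      unfolding integrable_restrict_space[OF set\<Omega>] by (simp only:)
  qed
  have "(LINT x|lebesgue_on \<Omega>. form_norm k (\<lambda>vs. h x * \<alpha> vs) powr p) \<le>
      (LINT x|lebesgue_on \<Omega>. ?c powr p * \<bar>h x\<bar>)"
  proof (intro integral_mono integrable_mult_right int\<Omega>)
    show "integrable (lebesgue_on \<Omega>) (\<lambda>x. form_norm k (\<lambda>vs. h x * \<alpha> vs) powr p)"
      using form_scale_in_Lp_forms[OF p \<Omega>(1) bdd \<alpha> h h1] by (simp add: Lp_forms_def)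
    show "form_norm k (\<lambda>vs. h x * \<alpha> vs) powr p \<le> ?c powr p * \<bar>h x\<bar>" for x
    proof -
      have "\<bar>h x\<bar> powr p \<le> \<bar>h x\<bar> powr 1"
        using p h1[of x] by (intro powr_mono') auto
      then show ?thesis
        by (simp add: form_norm_scale powr_mult form_norm_nonneg mult.commute[of "form_norm k \<alpha> powr p"]
            mult_right_mono)
    qed
  qed
  also have "\<dots> = ?c powr p * (LINT x|lebesgue_on \<Omega>. \<bar>h x\<bar>)"
    by simp
  also have "(LINT x|lebesgue_on \<Omega>. \<bar>h x\<bar>) \<le> (LINT x|lebesgue_on Q. \<bar>h x\<bar>)"
    unfolding integral_restrict_space[OF setQ] integral_restrict_space[OF set\<Omega>]
    using intQ int\<Omega> \<Omega>(2)
    by (intro integral_mono) (auto simp: integrable_restrict_space[OF setQ] integrable_restrict_space[OF set\<Omega>] indicator_def)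
  finally have le: "(LINT x|lebesgue_on \<Omega>. form_norm k (\<lambda>vs. h x * \<alpha> vs) powr p) \<le>
      ?c powr p * (LINT x|lebesgue_on Q. \<bar>h x\<bar>)"
    by (simp add: mult_left_mono)
  have "Lp_norm \<Omega> p k (\<lambda>x vs. h x * \<alpha> vs) \<le> (?c powr p * (LINT x|lebesgue_on Q. \<bar>h x\<bar>)) powr (1 / p)"
    unfolding Lp_norm_def using p le by (intro powr_mono2) (auto intro: integral_nonneg_AE)
  also have "\<dots> = ?c * (LINT x|lebesgue_on Q. \<bar>h x\<bar>) powr (1 / p)"
    using p by (simp add: powr_mult powr_powr form_norm_nonneg)
  finally show ?thesis .
qed

text \<open>
  If \<open>T\<close> does not tend to \<open>0\<close> along the sequence, then \<open>N\<close> of its members, with suitable signs, have a sum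
  on which \<open>T\<close> is at least \<open>N \<epsilon>\<close>, while orthogonality makes the norm of that sum \<open>o(N)\<close>. This covers all
  \<open>p \<ge> 1\<close> without a representation of the dual.
\<close>

lemma orthogonal_weakly_null:
  fixes \<Omega> Q :: "(real^'n::finite) set" and g :: "nat \<Rightarrow> real^'n \<Rightarrow> real"
  assumes p: "1 \<le> p" and \<Omega>: "open \<Omega>" "\<Omega> \<subseteq> Q" "compact Q" and \<alpha>: "\<alpha> \<in> alternating_forms k"
    and g: "\<And>\<nu>. continuous_on UNIV (g \<nu>)" and g1: "\<And>\<nu> x. \<bar>g \<nu> x\<bar> \<le> 1"
    and orth: "\<And>\<nu> \<mu>. \<nu> \<noteq> \<mu> \<Longrightarrow> (LINT x|lebesgue_on Q. g \<nu> x * g \<mu> x) = 0"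
  shows "Lp_weakly_converges \<Omega> p k (\<lambda>\<nu> x vs. g \<nu> x * \<alpha> vs) (\<lambda>x vs. 0)"
  unfolding Lp_weakly_converges_def
proof
  fix T :: "(real^'n \<Rightarrow> 'n form) \<Rightarrow> real"
  assume T: "T \<in> Lp_dual \<Omega> p k"
  have bdd: "bounded \<Omega>"
    using \<Omega> bounded_subset compact_imp_bounded by blast
  define L where "L h = T (\<lambda>x vs. h x * \<alpha> vs)" for h :: "real^'n \<Rightarrow> real"
  note Lp = form_scale_in_Lp_forms[OF p \<Omega>(1) bdd \<alpha>]
  have add: "T (\<lambda>x vs. u x vs + v x vs) = T u + T v" if "u \<in> Lp_forms \<Omega> p k" "v \<in> Lp_forms \<Omega> p k" for u v
    using T that by (simp add: Lp_dual_def)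
  have scale: "T (\<lambda>x vs. c * u x vs) = c * T u" if "u \<in> Lp_forms \<Omega> p k" for c u
    using T that by (simp add: Lp_dual_def)
  obtain C0 where C0: "\<And>u. u \<in> Lp_forms \<Omega> p k \<Longrightarrow> \<bar>T u\<bar> \<le> C0 * Lp_norm \<Omega> p k u"
    using T unfolding Lp_dual_def by blast
  define C where "C = \<bar>C0\<bar> * form_norm k \<alpha>"
  have C: "0 \<le> C"
    by (simp add: C_def form_norm_nonneg)
  have L_scale: "L (\<lambda>x. c * h x) = c * L h" if "continuous_on UNIV h" "\<And>x. \<bar>h x\<bar> \<le> B" for c h B
    using scale[OF Lp[OF that], of c] by (simp add: L_def mult.assoc)
  \<comment> \<open>The zero form is \<open>0\<close> times a member of the sequence, so homogeneity
    gives the value.\<close>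
  have T0: "T (\<lambda>x vs. 0) = 0"
    using scale[OF Lp[OF g g1], of 0] by simp
  have L_sum: "L (\<lambda>x. \<Sum>\<nu>\<in>F. a \<nu> * g \<nu> x) = (\<Sum>\<nu>\<in>F. a \<nu> * L (g \<nu>))" if "finite F" for F a
    using that
  proof induction
    case empty
    then show ?case
      by (simp add: L_def T0)
  next
    case (insert \<mu> F)
    have cont: "continuous_on UNIV (\<lambda>x. \<Sum>\<nu>\<in>F. a \<nu> * g \<nu> x)" "continuous_on UNIV (\<lambda>x. a \<mu> * g \<mu> x)"
      by (intro continuous_intros g)+
    have bound: "\<bar>a \<mu> * g \<mu> x\<bar> \<le> \<bar>a \<mu>\<bar>" for \<mu> x
      using g1[of \<mu> x] by (simp add: abs_mult mult_left_le)
    have "\<bar>\<Sum>\<nu>\<in>F. a \<nu> * g \<nu> x\<bar> \<le> (\<Sum>\<nu>\<in>F. \<bar>a \<nu>\<bar>)" for x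
      by (rule order_trans[OF sum_abs sum_mono[OF bound]])
    from add[OF Lp[OF cont(2) bound] Lp[OF cont(1) this]] show ?case
      using insert L_scale[OF g[of \<mu>] g1[of \<mu>], of "a \<mu>"] by (simp add: L_def distrib_right)
  qed
  \<comment> \<open>The quantitative core: a set of \<open>N\<close> indices on which
    \<open>L\<close> stays above \<open>\<epsilon>\<close> bounds \<open>\<epsilon>\<close> by a
    quantity that tends to \<open>0\<close> as \<open>N\<close> grows.\<close>
  have key: "\<epsilon> \<le> C * (measure lebesgue Q / sqrt (card F)) powr (1 / p)"
    if F: "finite F" "F \<noteq> {}" and \<epsilon>: "\<And>\<nu>. \<nu> \<in> F \<Longrightarrow> \<epsilon> \<le> \<bar>L (g \<nu>)\<bar>" for F \<epsilon>
  proof -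
    \<comment> \<open>The signs make each \<open>a \<nu> * L (g \<nu>)\<close> equal to
      \<open>\<bar>L (g \<nu>)\<bar>\<close>. Dividing by \<open>card F\<close> then keeps
      \<open>\<bar>h x\<bar> \<le> 1\<close>, as \<open>Lp_norm_form_scale_le\<close>
      requires.\<close>
    define a where "a \<nu> = sgn (L (g \<nu>))" for \<nu>
    define h where "h x = (\<Sum>\<nu>\<in>F. a \<nu> * g \<nu> x) / card F" for x
    have a1: "\<bar>a \<nu>\<bar> \<le> 1" for \<nu>
      by (simp add: a_def sgn_real_def)
    have N: "0 < real (card F)"
      using F by (simp add: card_gt_0_iff)
    have cont: "continuous_on UNIV h"
      unfolding h_def using N by (intro continuous_intros g) auto
    have "\<bar>\<Sum>\<nu>\<in>F. a \<nu> * g \<nu> x\<bar> \<le> real (card F) * 1" for x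
      using mult_mono[OF a1 g1] by (intro order_trans[OF sum_abs sum_bounded_above]) (simp add: abs_mult)
    then have h1: "\<bar>h x\<bar> \<le> 1" for x
      using N by (simp add: h_def)
    have "real (card F) * \<epsilon> \<le> (\<Sum>\<nu>\<in>F. \<bar>L (g \<nu>)\<bar>)"
      using \<epsilon> by (rule sum_bounded_below)
    also have "\<dots> = L (\<lambda>x. \<Sum>\<nu>\<in>F. a \<nu> * g \<nu> x)"
      using L_sum[OF F(1), of a] by (simp add: a_def abs_sgn mult.commute)
    also have "(\<lambda>x. \<Sum>\<nu>\<in>F. a \<nu> * g \<nu> x) = (\<lambda>x. real (card F) * h x)"
      using N by (simp add: h_def)
    also have "L \<dots> = real (card F) * L h"
      using L_scale[OF cont h1] .
    finally have "\<epsilon> \<le> L h"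
      using N by simp
    also have "\<dots> \<le> C0 * Lp_norm \<Omega> p k (\<lambda>x vs. h x * \<alpha> vs)"
      using C0[OF Lp[OF cont h1]] by (simp add: L_def)
    also have "\<dots> \<le> \<bar>C0\<bar> * Lp_norm \<Omega> p k (\<lambda>x vs. h x * \<alpha> vs)"
      by (intro mult_right_mono) (auto simp: Lp_norm_def)
    also have "\<dots> \<le> \<bar>C0\<bar> * (form_norm k \<alpha> * (LINT x|lebesgue_on Q. \<bar>h x\<bar>) powr (1 / p))"
      by (intro mult_left_mono Lp_norm_form_scale_le p \<Omega> \<alpha> cont h1) auto
    also have "\<dots> = C * (LINT x|lebesgue_on Q. \<bar>h x\<bar>) powr (1 / p)"
      by (simp add: C_def)
    also have "\<dots> \<le> C * (measure lebesgue Q / sqrt (card F)) powr (1 / p)"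
      using p integral_abs_signed_sum_le[OF \<Omega>(3) F g g1 a1 orth]
      by (intro mult_left_mono C powr_mono2) (auto simp: h_def)
    finally show ?thesis .
  qed
  have "(\<lambda>\<nu>. L (g \<nu>)) \<longlonglongrightarrow> 0"
  proof (rule ccontr)
    assume "\<not> ?thesis"
    then obtain \<epsilon> where \<epsilon>: "0 < \<epsilon>" "\<And>m. \<exists>\<nu>\<ge>m. \<epsilon> \<le> \<bar>L (g \<nu>)\<bar>"
      by (auto simp: LIMSEQ_def not_less)
    \<comment> \<open>Infinitely many bad indices allow \<open>key\<close> to be applied to sets of
      every size, which forces \<open>\<epsilon> \<le> 0\<close>.\<close>
    then have inf: "infinite {\<nu>. \<epsilon> \<le> \<bar>L (g \<nu>)\<bar>}"
      by (auto simp: infinite_nat_iff_unbounded_le)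
    have "\<epsilon> \<le> C * (measure lebesgue Q / sqrt (Suc N)) powr (1 / p)" for N
    proof -
      obtain F where F: "finite F" "card F = Suc N" "F \<subseteq> {\<nu>. \<epsilon> \<le> \<bar>L (g \<nu>)\<bar>}"
        using infinite_arbitrarily_large[OF inf] by blast
      then have "F \<noteq> {}"
        by auto
      then show ?thesis
        using key[of F \<epsilon>] F by auto
    qed
    moreover have "(\<lambda>N. C * (measure lebesgue Q / sqrt (Suc N)) powr (1 / p)) \<longlonglongrightarrow> C * 0"
    proof (intro tendsto_mult tendsto_const tendsto_zero_powrI)
      have "filterlim (\<lambda>N. sqrt (real (Suc N))) at_top sequentially"
        by (rule filterlim_compose[OF sqrt_at_top filterlim_compose[OF filterlim_real_sequentially filterlim_Suc]])
      then show "(\<lambda>N. measure lebesgue Q / sqrt (Suc N)) \<longlonglongrightarrow> 0"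
        by (intro tendsto_divide_0[OF tendsto_const] filterlim_at_top_imp_at_infinity)
      show "(\<lambda>N. 1 / p) \<longlonglongrightarrow> 1 / p" "0 < 1 / p"
        using p by auto
    qed auto
    ultimately have "\<epsilon> \<le> 0"
      by (intro LIMSEQ_le_const[of "\<lambda>N. C * (measure lebesgue Q / sqrt (Suc N)) powr (1 / p)"]) auto
    then show False
      using \<epsilon>(1) by simp
  qed
  then show "(\<lambda>\<nu>. T (\<lambda>x vs. g \<nu> x * \<alpha> vs)) \<longlonglongrightarrow> T (\<lambda>x vs. 0)"
    by (simp add: L_def T0)
qed

section \<open>Failure of lower semicontinuity\<close>

theorem proposition4p17:
  fixes \<Omega> :: "(real^'n::finite) set" and p :: real and k :: nat
  assumes "2 \<le> CARD('n)" and "2 \<le> k" and "k \<le> CARD('n)" and "1 \<le> p"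
    and "\<Omega> \<noteq> {}" and "open \<Omega>" and "bounded \<Omega>"
  shows "\<not> seq_weakly_lsc \<Omega> p (k - 1)
    (\<lambda>\<omega>. 1 / p * (LINT x|lebesgue_on \<Omega>. form_norm k (ext_deriv \<Omega> p (k - 1) \<omega> x) powr p)
       - 1 / p * (LINT x|lebesgue_on \<Omega>. form_norm (k - 1) (\<omega> x) powr p))"
proof
  define r where "r = k - 1"
  have r: "1 \<le> r" "k = Suc r"
    using assms(2) by (auto simp: r_def)
  let ?F = "\<lambda>\<omega>. 1 / p * (LINT x|lebesgue_on \<Omega>. form_norm k (ext_deriv \<Omega> p r \<omega> x) powr p)
       - 1 / p * (LINT x|lebesgue_on \<Omega>. form_norm r (\<omega> x) powr p)"
  assume "seq_weakly_lsc \<Omega> p (k - 1)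
    (\<lambda>\<omega>. 1 / p * (LINT x|lebesgue_on \<Omega>. form_norm k (ext_deriv \<Omega> p (k - 1) \<omega> x) powr p)
       - 1 / p * (LINT x|lebesgue_on \<Omega>. form_norm (k - 1) (\<omega> x) powr p))"
  then have lsc: "seq_weakly_lsc \<Omega> p r ?F"
    by (simp add: r_def)
  obtain e :: "nat \<Rightarrow> 'n" where "bij_betw e {0..<CARD('n)} UNIV"
    using ex_bij_betw_nat_finite[of "UNIV :: 'n set"] by auto
  then have e: "inj_on e {..<r}"
    using assms(3) r by (auto simp: bij_betw_def intro: inj_on_subset)
  define \<alpha> where "\<alpha> = coord_form e r"
  have \<alpha>: "\<alpha> \<in> alternating_forms r"
    by (simp add: \<alpha>_def coord_form_alternating)
  define b where "b = (1 / 2) powr p * measure lebesgue \<Omega> / 2"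
  \<comment> \<open>Choice selects a good phase for each frequency separately.\<close>
  have "\<exists>\<theta>. \<forall>\<nu>. b \<le> (LINT x|lebesgue_on \<Omega>. \<bar>sin (real \<nu> * vec_nth x (e 0) + \<theta> \<nu>)\<bar> powr p)"
    using oscillation_phase_lower_bound[OF assms(6,7)] assms(4) unfolding b_def by (intro choice) auto
  then obtain \<theta> where
    \<theta>: "\<And>\<nu>. b \<le> (LINT x|lebesgue_on \<Omega>. \<bar>sin (real \<nu> * vec_nth x (e 0) + \<theta> \<nu>)\<bar> powr p)"
    by blast
  define \<omega>s where "\<omega>s \<nu> x vs = sin (real \<nu> * vec_nth x (e 0) + \<theta> \<nu>) * \<alpha> vs"
    for \<nu> and x :: "real^'n" and vs
  define z where "z = (\<lambda>(x::real^'n) (vs::(real^'n) list). 0::real)"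
  obtain M where M: "\<Omega> \<subseteq> pi_cube M"
    using bounded_subset_pi_cube[OF assms(7)] .
  have weak: "Lp_weakly_converges \<Omega> p r \<omega>s z"
    unfolding \<omega>s_def[abs_def] z_def
    by (rule orthogonal_weakly_null[OF assms(4,6) M _ \<alpha>])
       (simp_all add: orthogonal_oscillations, simp_all add: pi_cube_cbox continuous_intros)
  \<comment> \<open>For the oscillating forms and for \<open>z\<close> alike, the condition on
    \<open>\<eta>\<close> says that its components integrate to \<open>0\<close> against all test
    functions.\<close>
  have ext_iff: "has_ext_deriv \<Omega> r (\<omega>s \<nu>) \<eta> \<longleftrightarrow> has_ext_deriv \<Omega> r z \<eta>" for \<nu> \<eta>
  proof -
    have "continuous_on UNIV (\<lambda>t. sin (real \<nu> * t + \<theta> \<nu>))"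
      by (intro continuous_intros)
    from has_ext_deriv_oscillation_iff[OF assms(6) r(1) this, of e \<eta>] show ?thesis
      by (simp add: \<omega>s_def[abs_def] z_def \<alpha>_def has_ext_deriv_def)
  qed
  \<comment> \<open>As the choice is from the same set, uniqueness of the weak derivative almost everywhere is not needed.\<close>
  have ext: "ext_deriv \<Omega> p r (\<omega>s \<nu>) = ext_deriv \<Omega> p r z" for \<nu>
    unfolding ext_deriv_def ext_iff ..
  \<comment> \<open>The degree \<open>m\<close> is left free because \<open>z\<close> serves both as
    the limit, of degree \<open>r\<close>, and as its own exterior derivative, of degree
    \<open>Suc r\<close>.\<close>
  have z_Lp: "z \<in> Lp_forms \<Omega> p m" for m
  proof -
    have "(\<lambda>vs. 0) \<in> alternating_forms m"
      by (simp add: alternating_forms_def linear_iff)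
    from form_scale_in_Lp_forms[OF assms(4,6,7) this, of "\<lambda>_. 0" 0] show ?thesis
      by (simp add: z_def)
  qed
  have \<omega>s_Lp: "\<omega>s \<nu> \<in> Lp_forms \<Omega> p r" for \<nu>
    unfolding \<omega>s_def[abs_def]
    by (rule form_scale_in_Lp_forms[OF assms(4,6,7) \<alpha>, where B = 1]) (auto intro!: continuous_intros)
  have z_ext: "has_ext_deriv \<Omega> r z z"
    by (simp add: has_ext_deriv_def z_def)
  have "\<omega>s \<nu> \<in> Wdp \<Omega> p r" "z \<in> Wdp \<Omega> p r" for \<nu>
    using z_ext z_Lp \<omega>s_Lp by (auto simp: Wdp_def ext_iff)
  \<comment> \<open>By \<open>ext\<close> the sequence of exterior derivatives is constant, so its
    weak convergence is immediate.\<close>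
  moreover have "Wdp_weakly_converges \<Omega> p r \<omega>s z"
    using weak by (simp add: Wdp_weakly_converges_def Lp_weakly_converges_def ext)
  ultimately have le: "ereal (?F z) \<le> liminf (\<lambda>\<nu>. ereal (?F (\<omega>s \<nu>)))"
    using lsc unfolding seq_weakly_lsc_def by blast
  define c where "c = form_norm r \<alpha> powr p"
  \<comment> \<open>The derivative terms agree by \<open>ext\<close>, and the second term is
    \<open>0\<close> at \<open>z\<close>. Along the sequence it is at least
    \<open>1 / p * (c * b)\<close>, a gap independent of \<open>\<nu>\<close> that survives the
    lower limit.\<close>
  have drop: "?F (\<omega>s \<nu>) \<le> ?F z - 1 / p * (c * b)" for \<nu>
  proof -
    have "(LINT x|lebesgue_on \<Omega>. form_norm r (z x) powr p) = 0"
      by (simp add: z_def form_norm_def)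
    moreover have "(LINT x|lebesgue_on \<Omega>. form_norm r (\<omega>s \<nu> x) powr p) =
        c * (LINT x|lebesgue_on \<Omega>. \<bar>sin (real \<nu> * vec_nth x (e 0) + \<theta> \<nu>)\<bar> powr p)"
      by (simp add: \<omega>s_def[abs_def] form_norm_scale powr_mult form_norm_nonneg c_def
          mult.commute[of "form_norm r \<alpha> powr p"])
    moreover have "c * b \<le> c * (LINT x|lebesgue_on \<Omega>. \<bar>sin (real \<nu> * vec_nth x (e 0) + \<theta> \<nu>)\<bar> powr p)"
      using \<theta> by (intro mult_left_mono) (auto simp: c_def)
    ultimately show ?thesis
      using assms(4) by (simp add: ext divide_right_mono)
  qed
  note le
  also have "liminf (\<lambda>\<nu>. ereal (?F (\<omega>s \<nu>))) \<le> liminf (\<lambda>\<nu>. ereal (?F z - 1 / p * (c * b)))"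
    by (intro Liminf_mono always_eventually allI) (simp only: ereal_less_eq drop)
  also have "\<dots> = ereal (?F z - 1 / p * (c * b))"
    by (rule Liminf_const) simp
  finally have "?F z \<le> ?F z - 1 / p * (c * b)"
    by (simp only: ereal_less_eq)
  moreover have "0 < c"
    using form_norm_coord_form_pos[OF e] by (simp add: c_def \<alpha>_def)
  moreover have "0 < b"
  proof -
    \<comment> \<open>A nonempty open set is not negligible; boundedness makes its measure
      finite.\<close>
    have "measure lebesgue \<Omega> \<noteq> 0"
      using assms(5-7) open_not_negligible negligible_iff_measure lmeasurable_open by blast
    then show ?thesis
      unfolding b_def by (intro divide_pos_pos mult_pos_pos) (auto simp only: zero_less_measure_iff, auto)
  qed
  ultimately show False
    using assms(4) by (simp add: divide_le_0_iff mult_le_0_iff)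
qed

end
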